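(* Let $E,J,R:\mathcal{M}\to\mathbb{R}^{n\times n}$, $B,P:\mathcal{M}\to\mathbb{R}^{n\times m}$ and $S,N:\mathcal{M}\to\mathbb{R}^{m\times m}$ be matrix-valued functions, with $E,J,R\in\mathcal{F}^{n,n}$, $B,P\in\mathcal{F}^{n,m}$, $S,N\in\mathcal{F}^{m,m}$, such that for almost all $\mu\in\mathcal{M}$ the matrix $E(\mu)$ is non-singular and $$E(\mu)\dot{x}=(J(\mu)-R(\mu))x+(B(\mu)-P(\mu))u,\qquad y=(B(\mu)+P(\mu))^\top x+(S(\mu)+N(\mu))u$$ is a port-Hamiltonian system with $Q=I_n$. For an integer $s\ge 1$ put $\hat{E}=\mathscr{G}_s(E)$, $\hat{J}=\mathscr{G}_s(J)$, $\hat{R}=\mathscr{G}_s(R)$, $\hat{B}=\mathscr{G}_s(B)$, $\hat{P}=\mathscr{G}_s(P)$, $\hat{S}=\mathscr{G}_s(S)$, $\hat{N}=\mathscr{G}_s(N)$. Then the stochastic Galerkin system $$\hat{E}\dot{\hat{v}}=(\hat{J}-\hat{R})\hat{v}+(\hat{B}-\hat{P})\hat{u},\qquad \hat{w}=(\hat{B}+\hat{P})^\top\hat{v}+(\hat{S}+\hat{N})\hat{u},$$ with state $\hat{v}(t)\in\mathbb{R}^{ns}$, input $\hat{u}(t)\in\mathbb{R}^{ms}$ and output $\hat{w}(t)\in\mathbb{R}^{ms}$, is a system of ordinary differential equations (i.e., $\hat{E}$ is non-singular) and is again a port-Hamiltonian system (with $\hat{Q}=I_{ns}$).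
   Context: **Port-Hamiltonian (pH) system.** $\mathcal{S}^n_{\succeq}$ denotes the set of real symmetric positive semi-definite $n\times n$ matrices. A linear first-order pH system has the form $$E\dot{x}=(J-R)Qx+(B-P)u,\qquad y=(B+P)^\top Qx+(S+N)u$$ with $E,J,R,Q\in\mathbb{R}^{n\times n}$, $B,P\in\mathbb{R}^{n\times m}$, $S,N\in\mathbb{R}^{m\times m}$ such that $J$ and $N$ are skew-symmetric, $E^\top Q\in\mathcal{S}^n_{\succeq}$, and $$\begin{pmatrix}Q^\top RQ & Q^\top P\\ P^\top Q & S\end{pmatrix}\in\mathcal{S}^{n+m}_{\succeq}.$$ **Stochastic setting.** The parameters $\mu\in\mathcal{M}\subseteq\mathbb{R}^q$ are independent random variables on a probability space, $\mu:\Omega\to\mathcal{M}$, with joint probability density $\rho:\mathcal{M}\to\mathbb{R}$. Expected values are $\mathbb{E}[f]=\int_{\mathcal{M}}f(\mu)\rho(\mu)\,\mathrm{d}\mu$, and $\langle f,g\rangle=\mathbb{E}[fg]$ is the inner product on $\mathcal{L}^2(\mathcal{M},\rho)=\{f:\mathcal{M}\to\mathbb{R}\text{ measurable}:\mathbb{E}[f^2]<\infty\}$. $(\Phi_i)_{i\in\mathbb{N}}$ is an orthonormal basis of $\mathcal{L}^2(\mathcal{M},\rho)$ consisting of polynomials, with $\Phi_1\equiv 1$. "Almost all $\mu$" is with respect to the probability measure $\rho(\mu)\,\mathrm{d}\mu$. **Stochastic Galerkin projection.** $\mathcal{F}^{n,m}$ is the set of all measurable $A=(a_{k\ell}):\mathcal{M}\to\mathbb{R}^{n\times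 m}$ such that $\hat{a}_{ijk\ell}=\mathbb{E}[a_{k\ell}\Phi_i\Phi_j]$ is finite (i.e., the integral exists and is finite) for all $i,j\in\mathbb{N}$, $1\le k\le n$, $1\le\ell\le m$. For $A\in\mathcal{F}^{n,m}$ and $s\ge1$, $\mathscr{G}_s(A)\in\mathbb{R}^{ns\times ms}$ is the block matrix $(\hat{A}_{ij})_{i,j=1,\dots,s}$ with blocks $\hat{A}_{ij}=(\hat{a}_{ijk\ell})_{k,\ell}\in\mathbb{R}^{n\times m}$. *)

theory Defs
  imports "HOL-Probability.Probability" "Jordan_Normal_Form.Matrix"
begin

(* HOL-Analysis and Jordan_Normal_Form both use $ for vector components; below it is
   the component of an element of real ^ 'q.  Matrices whose dimensions depend on n, m, s are
   Jordan_Normal_Form matrices with entries A $$ (k, l). *)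
no_notation Matrix.vec_index (infixl \<open>$\<close> 100)

definition psd_mats :: "nat \<Rightarrow> real mat set" where
  "psd_mats n = {A \<in> carrier_mat n n. transpose_mat A = A \<and>
     (\<forall>v \<in> carrier_vec n. 0 \<le> scalar_prod v (A *\<^sub>v v))}"

(* Descriptor E A B C D is the system  E x' = A x + B u,  y = C x + D u,
   identified with its coefficient matrices. *)
datatype descriptor_system =
  Descriptor "real mat" "real mat" "real mat" "real mat" "real mat"

(* n is the state dimension, m the dimension of input and output. *)
definition port_hamiltonian ::
    "nat \<Rightarrow> nat \<Rightarrow> descriptor_system \<Rightarrow> real mat \<Rightarrow> real mat \<Rightarrow> real mat \<Rightarrow> real mat
      \<Rightarrow> real mat \<Rightarrow> real mat \<Rightarrow> real mat \<Rightarrow> real mat \<Rightarrow> bool" where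
  "port_hamiltonian n m sys E J R Q B P S N \<longleftrightarrow>
     sys = Descriptor E ((J - R) * Q) (B - P) (transpose_mat (B + P) * Q) (S + N) \<and>
     E \<in> carrier_mat n n \<and> J \<in> carrier_mat n n \<and> R \<in> carrier_mat n n \<and> Q \<in> carrier_mat n n \<and>
     B \<in> carrier_mat n m \<and> P \<in> carrier_mat n m \<and>
     S \<in> carrier_mat m m \<and> N \<in> carrier_mat m m \<and>
     transpose_mat J = - J \<and> transpose_mat N = - N \<and>
     transpose_mat E * Q \<in> psd_mats n \<and>
     four_block_mat (transpose_mat Q * R * Q) (transpose_mat Q * P)
                    (transpose_mat P * Q)     S               \<in> psd_mats (n + m)"

(* The probability measure with density rho on the parameter domain M.  Expected values are
   integrals with respect to it; cf. integral_density. *)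
definition param_measure :: "(real ^ 'q) set \<Rightarrow> (real ^ 'q \<Rightarrow> real) \<Rightarrow> (real ^ 'q) measure" where
  "param_measure M \<rho> = density (restrict_space lborel M) (\<lambda>x. ennreal (\<rho> x))"

definition L2_space :: "'a measure \<Rightarrow> ('a \<Rightarrow> real) set" where
  "L2_space D = {f \<in> borel_measurable D. integrable D (\<lambda>x. (f x)\<^sup>2)}"

(* Basis in the Hilbert space sense: every f is the L2-limit of its Fourier partial sums. *)
definition orthonormal_basis :: "'a measure \<Rightarrow> (nat \<Rightarrow> 'a \<Rightarrow> real) \<Rightarrow> bool" where
  "orthonormal_basis D \<Phi> \<longleftrightarrow>
     (\<forall>i. \<Phi> i \<in> L2_space D) \<and>
     (\<forall>i j. (LINT x|D. \<Phi> i x * \<Phi> j x) = (if i = j then 1 else 0)) \<and>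
     (\<forall>f \<in> L2_space D.
        (\<lambda>K. LINT x|D. (f x - (\<Sum>i<K. (LINT y|D. f y * \<Phi> i y) * \<Phi> i x))\<^sup>2) \<longlonglongrightarrow> 0)"

(* The class written F^{n,m} in the literature.  All indices are 0-based here, so \<Phi> 0
   is the constant basis function. *)
definition galerkin_class ::
    "'a measure \<Rightarrow> (nat \<Rightarrow> 'a \<Rightarrow> real) \<Rightarrow> nat \<Rightarrow> nat \<Rightarrow> ('a \<Rightarrow> real mat) set" where
  "galerkin_class D \<Phi> n m =
     {A. (\<forall>x \<in> space D. A x \<in> carrier_mat n m) \<and>
         (\<forall>k<n. \<forall>l<m. (\<lambda>x. A x $$ (k, l)) \<in> borel_measurable D \<and>
            (\<forall>i j. integrable D (\<lambda>x. A x $$ (k, l) * \<Phi> i x * \<Phi> j x)))}"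

(* s x s blocks of size n x m: row r = i * n + k and column c = j * m + l hold entry (k, l) of
   block (i, j). *)
definition galerkin ::
    "'a measure \<Rightarrow> (nat \<Rightarrow> 'a \<Rightarrow> real) \<Rightarrow> nat \<Rightarrow> nat \<Rightarrow> nat \<Rightarrow> ('a \<Rightarrow> real mat) \<Rightarrow> real mat" where
  "galerkin D \<Phi> n m s A = Matrix.mat (n * s) (m * s)
     (\<lambda>(r, c). LINT x|D. A x $$ (r mod n, c mod m) * \<Phi> (r div n) x * \<Phi> (c div m) x)"

end

theory Submission
  imports Defs "Jordan_Normal_Form.Determinant"
begin

no_notation Matrix.vec_index (infixl \<open>$\<close> 100)

text \<open>
  For a coefficient vector v put w = sum_i v_i \<Phi>_i, an R^n-valued function of the parameter.
  Then u^T G_s(A) v is the expectation of w_u^T A w_v, so symmetry, skew-symmetry and positive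
  semi-definiteness pass from A to G_s(A).  A non-singular positive semi-definite matrix is
  positive definite; hence v^T G_s(E) v = 0 forces w = 0 almost everywhere, and orthonormality
  of the basis gives v = 0.
\<close>

section \<open>Scalar products, invertibility and semi-definite real matrices\<close>

lemma scalar_prod_lessThan: "scalar_prod v w = (\<Sum>i<dim_vec w. vec_index v i * vec_index w i)"
  by (simp add: scalar_prod_def atLeast0LessThan)

lemma scalar_prod_mult_mat_vec:
  assumes "A \<in> carrier_mat n m" and "u \<in> carrier_vec n" and "v \<in> carrier_vec m"
  shows "scalar_prod u (A *\<^sub>v v) =
    (\<Sum>k<n. \<Sum>l<m. vec_index u k * (A $$ (k, l) * vec_index v l))"
  using assms by (simp add: scalar_prod_lessThan sum_distrib_left)

lemma scalar_prod_real_self_nonneg: "0 \<le> scalar_prod v (v :: real vec)"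
  by (simp add: scalar_prod_lessThan sum_nonneg)

lemma scalar_prod_real_self_eq_0:
  fixes v :: "real vec"
  assumes "v \<in> carrier_vec n" and "scalar_prod v v = 0"
  shows "v = 0\<^sub>v n"
proof (rule eq_vecI)
  fix i assume "i < dim_vec (0\<^sub>v n :: real vec)"
  moreover have "\<forall>i\<in>{..<dim_vec v}. vec_index v i * vec_index v i = 0"
    using assms(2) by (subst sum_nonneg_eq_0_iff[symmetric]) (auto simp: scalar_prod_lessThan)
  ultimately show "vec_index v i = vec_index (0\<^sub>v n) i"
    using assms(1) by auto
qed (use assms in auto)

lemma invertible_mat_iff_det:
  fixes A :: "'a :: field mat"
  assumes A: "A \<in> carrier_mat n n"
  shows "invertible_mat A \<longleftrightarrow> det A \<noteq> 0"
proof
  assume "invertible_mat A"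
  then obtain B where AB: "A * B = 1\<^sub>m (dim_row A)" and BA: "B * A = 1\<^sub>m (dim_row B)"
    by (auto simp: invertible_mat_def inverts_mat_def)
  \<comment> \<open>\<open>invertible_mat\<close> does not fix the shape of the inverse. The number
    of columns of \<open>A * B\<close> gives the columns of \<open>B\<close>, and that of
    \<open>B * A\<close> gives its rows.\<close>
  have "dim_col (A * B) = n" "dim_col (B * A) = dim_row B"
    using A unfolding AB BA by auto
  then have B: "B \<in> carrier_mat n n" using A by auto
  have "det A * det B = 1"
    using det_mult[OF A B] AB A by simp
  then show "det A \<noteq> 0" by auto
next
  assume "det A \<noteq> 0"
  from det_non_zero_imp_unit[OF A this, of "()"]
  obtain B where "B \<in> carrier_mat n n" "B * A = 1\<^sub>m n" "A * B = 1\<^sub>m n"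
    by (auto simp: Units_def ring_mat_simps)
  then show "invertible_mat A"
    using A by (auto simp: invertible_mat_def inverts_mat_def intro!: exI[of _ B])
qed

lemma invertible_mat_iff_kernel:
  fixes A :: "'a :: field mat"
  assumes "A \<in> carrier_mat n n"
  shows "invertible_mat A \<longleftrightarrow> (\<forall>v\<in>carrier_vec n. A *\<^sub>v v = 0\<^sub>v n \<longrightarrow> v = 0\<^sub>v n)"
  using invertible_mat_iff_det[OF assms] det_0_iff_vec_prod_zero_field[OF assms] by blast

text \<open>Move from \<open>v\<close> along \<open>y = A *\<^sub>v v\<close>. As the form vanishes
  at \<open>v\<close> and \<open>A\<close> is symmetric, its value at \<open>v + t y\<close> is 2 t
  a + t^2 b, where a is the squared norm of \<open>y\<close>. If a were positive, a small negative t
  would make this negative.\<close>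

lemma psd_mats_kernel:
  assumes A: "A \<in> psd_mats n" and v: "v \<in> carrier_vec n" and 0: "scalar_prod v (A *\<^sub>v v) = 0"
  shows "A *\<^sub>v v = 0\<^sub>v n"
proof -
  have Ac: "A \<in> carrier_mat n n" and At: "transpose_mat A = A"
    and pos: "\<And>w. w \<in> carrier_vec n \<Longrightarrow> 0 \<le> scalar_prod w (A *\<^sub>v w)"
    using A by (auto simp: psd_mats_def)
  define y where "y = A *\<^sub>v v"
  define a where "a = scalar_prod y y"
  define b where "b = scalar_prod y (A *\<^sub>v y)"
  have y: "y \<in> carrier_vec n" using Ac v by (simp add: y_def)
  have Ay: "A *\<^sub>v y \<in> carrier_vec n" using Ac y by simp
  have b: "0 \<le> b" using pos[OF y] by (simp add: b_def)
  have a: "0 \<le> a" by (simp add: a_def scalar_prod_real_self_nonneg)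
  have vAy: "scalar_prod v (A *\<^sub>v y) = a"
    using transpose_vec_mult_scalar[OF Ac y v] by (simp add: At a_def y_def)
  \<comment> \<open>The two terms \<open>t * a\<close> come from \<open>y\<close> paired with itself
    and from \<open>v\<close> paired with \<open>A *\<^sub>v y\<close>; the constant term vanishes
    by assumption.\<close>
  have quad: "0 \<le> t * a + (t * a + t * (t * b))" for t
  proof -
    have ty: "t \<cdot>\<^sub>v y \<in> carrier_vec n" "t \<cdot>\<^sub>v (A *\<^sub>v y) \<in> carrier_vec n" using y Ay by auto
    have "A *\<^sub>v (v + t \<cdot>\<^sub>v y) = y + t \<cdot>\<^sub>v (A *\<^sub>v y)"
      using mult_add_distrib_mat_vec[OF Ac v ty(1)] mult_mat_vec[OF Ac y] by (simp add: y_def)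
    moreover have "scalar_prod (v + t \<cdot>\<^sub>v y) (y + t \<cdot>\<^sub>v (A *\<^sub>v y)) =
        t * a + (t * a + t * (t * b))"
      using v y Ay ty 0 vAy
      by (simp add: add_scalar_prod_distrib[of _ n] scalar_prod_add_distrib[of _ n]
          a_def b_def flip: y_def)
    ultimately show ?thesis
      using pos[of "v + t \<cdot>\<^sub>v y"] v ty by simp
  qed
  have "a = 0"
  proof (rule ccontr)
    assume "a \<noteq> 0"
    with a have a: "0 < a" by simp
    \<comment> \<open>The choice t = - a / (b + 1) is small enough that t^2 b is at most |t| a, half
      the size of the linear term. The summand 1 keeps the denominator positive when b = 0.\<close>
    have "0 \<le> - (a / (b + 1)) * (2 * a - (a / (b + 1)) * b)"
      using quad[of "- (a / (b + 1))"] by (simp add: algebra_simps)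
    moreover have "(a / (b + 1)) * b \<le> a"
      using a b by (simp add: field_simps)
    then have "0 < (a / (b + 1)) * (2 * a - (a / (b + 1)) * b)"
      using a b by (intro mult_pos_pos) auto
    ultimately show False by simp
  qed
  then show ?thesis
    using scalar_prod_real_self_eq_0[OF y] by (simp add: a_def y_def)
qed

lemma invertible_psd_mats_definite:
  assumes "A \<in> psd_mats n" and "invertible_mat A"
    and "v \<in> carrier_vec n" and "scalar_prod v (A *\<^sub>v v) = 0"
  shows "v = 0\<^sub>v n"
  using assms psd_mats_kernel[OF assms(1,3,4)]
  by (subst (asm) invertible_mat_iff_kernel[of _ n]) (auto simp: psd_mats_def)

text \<open>Test vectors are split as \<open>a @\<^sub>v b\<close>. The two off-diagonal
  contributions are transposes of each other and hence equal as scalars, which produces the factor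
  2.\<close>

lemma four_block_psd_mats_iff:
  assumes R: "R \<in> carrier_mat n n" and P: "P \<in> carrier_mat n m" and S: "S \<in> carrier_mat m m"
  shows "four_block_mat R P (transpose_mat P) S \<in> psd_mats (n + m) \<longleftrightarrow>
    transpose_mat R = R \<and> transpose_mat S = S \<and>
    (\<forall>a\<in>carrier_vec n. \<forall>b\<in>carrier_vec m.
      0 \<le> scalar_prod a (R *\<^sub>v a) + 2 * scalar_prod a (P *\<^sub>v b) + scalar_prod b (S *\<^sub>v b))"
proof -
  let ?F = "four_block_mat R P (transpose_mat P) S"
  have Pt: "transpose_mat P \<in> carrier_mat m n" using P by simp
  have F: "?F \<in> carrier_mat (n + m) (n + m)" using R S by simp
  have "transpose_mat ?F = four_block_mat (transpose_mat R) P (transpose_mat P) (transpose_mat S)"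
    by (simp add: transpose_four_block_mat[OF R P Pt S])
  moreover have "four_block_mat (transpose_mat R) P (transpose_mat P) (transpose_mat S) = ?F \<longleftrightarrow>
      transpose_mat R = R \<and> transpose_mat S = S"
  proof
    \<comment> \<open>The off-diagonal blocks already agree; the entries at \<open>(i, j)\<close>
      and at \<open>(n + i, n + j)\<close> read off the two diagonal blocks.\<close>
    assume eq: "four_block_mat (transpose_mat R) P (transpose_mat P) (transpose_mat S) = ?F"
    have "transpose_mat R $$ (i, j) = R $$ (i, j)" if "i < n" "j < n" for i j
      using arg_cong[OF eq, of "\<lambda>X. X $$ (i, j)"] R S that by simp
    moreover have "transpose_mat S $$ (i, j) = S $$ (i, j)" if "i < m" "j < m" for i j
      using arg_cong[OF eq, of "\<lambda>X. X $$ (n + i, n + j)"] R S that by simp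
    ultimately show "transpose_mat R = R \<and> transpose_mat S = S"
      using R S by (auto intro!: eq_matI)
  qed auto
  moreover have "scalar_prod (a @\<^sub>v b) (?F *\<^sub>v (a @\<^sub>v b)) =
      scalar_prod a (R *\<^sub>v a) + 2 * scalar_prod a (P *\<^sub>v b) + scalar_prod b (S *\<^sub>v b)"
    if a: "a \<in> carrier_vec n" and b: "b \<in> carrier_vec m" for a b
  proof -
    have c: "R *\<^sub>v a \<in> carrier_vec n" "P *\<^sub>v b \<in> carrier_vec n"
      "transpose_mat P *\<^sub>v a \<in> carrier_vec m" "S *\<^sub>v b \<in> carrier_vec m"
      using R P S a b by auto
    have "scalar_prod b (transpose_mat P *\<^sub>v a) = scalar_prod a (P *\<^sub>v b)"
      using transpose_vec_mult_scalar[OF P b a] comm_scalar_prod[OF b c(3)] by simp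
    then show ?thesis
      using a b c
      by (simp add: four_block_mat_mult_vec[OF R P Pt S a b] scalar_prod_append[of _ n _ m]
          scalar_prod_add_distrib[of _ n] scalar_prod_add_distrib[of _ m])
  qed
  ultimately show ?thesis
    using F by (simp add: psd_mats_def all_vec_append)
qed

text \<open>Serves in both directions: it unpacks the hypothesis at each parameter value, and it
  reassembles the conclusion for the projected matrices.\<close>

lemma port_hamiltonian_one_iff:
  assumes "E \<in> carrier_mat n n" "J \<in> carrier_mat n n" "R \<in> carrier_mat n n"
    and "B \<in> carrier_mat n m" "P \<in> carrier_mat n m" "S \<in> carrier_mat m m" "N \<in> carrier_mat m m"
  shows "port_hamiltonian n m (Descriptor E (J - R) (B - P) (transpose_mat (B + P)) (S + N))
      E J R (1\<^sub>m n) B P S N \<longleftrightarrow>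
    transpose_mat J = - J \<and> transpose_mat N = - N \<and> E \<in> psd_mats n \<and>
    four_block_mat R P (transpose_mat P) S \<in> psd_mats (n + m)"
proof -
  have [simp]: "(J - R) * 1\<^sub>m n = J - R" "transpose_mat (B + P) * 1\<^sub>m n = transpose_mat (B + P)"
    "transpose_mat E * 1\<^sub>m n = transpose_mat E" "1\<^sub>m n * R * 1\<^sub>m n = R" "1\<^sub>m n * P = P"
    "transpose_mat P * 1\<^sub>m n = transpose_mat P"
    using assms by (auto intro!: right_mult_one_mat[of _ _ n])
  \<comment> \<open>Membership in \<open>psd_mats\<close> includes symmetry, so either side forces
    \<open>E\<close> to equal its transpose.\<close>
  have "transpose_mat E \<in> psd_mats n \<longleftrightarrow> E \<in> psd_mats n"
    by (auto simp: psd_mats_def)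
  then show ?thesis
    using assms by (simp add: port_hamiltonian_def)
qed

section \<open>Galerkin matrices as expectations of bilinear forms\<close>

lemma sum_lessThan_mult:
  fixes f :: "nat \<Rightarrow> 'a :: comm_monoid_add"
  shows "(\<Sum>r<n * s. f r) = (\<Sum>i<s. \<Sum>k<n. f (i * n + k))"
proof -
  have "(\<Sum>k<n. f (i * n + k)) = sum f {i * n..<i * n + n}" for i
    using sum.shift_bounds_nat_ivl[of f 0 "i * n" n] by (simp add: atLeast0LessThan add.commute)
  then show ?thesis
    by (simp add: sum.nat_group mult.commute)
qed

text \<open>The function w of the overview. Entry \<open>i * n + k\<close> of \<open>v\<close> is
  the coefficient of \<open>\<Phi> i\<close> in component \<open>k\<close>, matching the row
  numbering of \<open>galerkin\<close>.\<close>

definition galerkin_lift ::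
    "(nat \<Rightarrow> 'a \<Rightarrow> real) \<Rightarrow> nat \<Rightarrow> nat \<Rightarrow> real vec \<Rightarrow> 'a \<Rightarrow> real vec" where
  "galerkin_lift \<Phi> n s v x = vec n (\<lambda>k. \<Sum>i<s. vec_index v (i * n + k) * \<Phi> i x)"

lemma galerkin_lift_carrier [simp]: "galerkin_lift \<Phi> n s v x \<in> carrier_vec n"
  by (simp add: galerkin_lift_def)

lemma galerkin_carrier [simp]: "galerkin D \<Phi> n m s A \<in> carrier_mat (n * s) (m * s)"
  by (simp add: galerkin_def)

text \<open>The expansion is kept as a flat sum over \<open>r\<close> and \<open>c\<close>, so that
  each summand is a constant times the integrand of one entry of \<open>galerkin\<close>.\<close>

lemma galerkin_lift_form:
  assumes "A \<in> carrier_mat n m"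
  shows "scalar_prod (galerkin_lift \<Phi> n s u x) (A *\<^sub>v galerkin_lift \<Phi> m s v x) =
    (\<Sum>r<n * s. \<Sum>c<m * s. vec_index u r * (vec_index v c *
      (A $$ (r mod n, c mod m) * \<Phi> (r div n) x * \<Phi> (c div m) x)))"
proof -
  \<comment> \<open>The column sum is collapsed first, with \<open>p\<close> standing for the row
    factor \<open>\<Phi> (r div n) x\<close>; the row sum is then regrouped in the same way.\<close>
  have "(\<Sum>c<m * s. vec_index v c * (A $$ (k, c mod m) * p * \<Phi> (c div m) x)) =
      p * (\<Sum>l<m. A $$ (k, l) * (\<Sum>j<s. vec_index v (j * m + l) * \<Phi> j x))" for k p
    by (simp add: sum_lessThan_mult sum_distrib_left sum.swap[of _ "{..<s}"] ac_simps)
  then have "(\<Sum>r<n * s. \<Sum>c<m * s. vec_index u r * (vec_index v c *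
        (A $$ (r mod n, c mod m) * \<Phi> (r div n) x * \<Phi> (c div m) x))) =
      (\<Sum>r<n * s. vec_index u r * (\<Phi> (r div n) x *
        (\<Sum>l<m. A $$ (r mod n, l) * (\<Sum>j<s. vec_index v (j * m + l) * \<Phi> j x))))"
    by (simp flip: sum_distrib_left)
  also have "\<dots> = (\<Sum>k<n. (\<Sum>i<s. vec_index u (i * n + k) * \<Phi> i x) *
        (\<Sum>l<m. A $$ (k, l) * (\<Sum>j<s. vec_index v (j * m + l) * \<Phi> j x)))"
    by (simp add: sum_lessThan_mult sum_distrib_right sum.swap[of _ "{..<s}"] mult.assoc)
  finally show ?thesis
    using assms
    by (simp add: scalar_prod_mult_mat_vec[of _ n m] galerkin_lift_def sum_distrib_left)
qed

lemma galerkin_index: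
  assumes "r < n * s" and "c < m * s"
  shows "galerkin D \<Phi> n m s A $$ (r, c) =
    (LINT x|D. A x $$ (r mod n, c mod m) * \<Phi> (r div n) x * \<Phi> (c div m) x)"
  using assms by (simp add: galerkin_def)

text \<open>By linearity, the expectation of the pointwise expansion is taken term by term.
  \<open>has_bochner_integral\<close> carries integrability along with the value, which the later
  almost-everywhere arguments need.\<close>

lemma galerkin_form:
  assumes A: "A \<in> galerkin_class D \<Phi> n m"
    and u: "u \<in> carrier_vec (n * s)" and v: "v \<in> carrier_vec (m * s)"
  shows "has_bochner_integral D
    (\<lambda>x. scalar_prod (galerkin_lift \<Phi> n s u x) (A x *\<^sub>v galerkin_lift \<Phi> m s v x))
    (scalar_prod u (galerkin D \<Phi> n m s A *\<^sub>v v))"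
proof -
  \<comment> \<open>Since \<open>r mod 0 = r\<close>, the bound \<open>r mod n < n\<close> requires
    \<open>n\<close> to be positive; the existence of an index below \<open>n * s\<close> ensures
    this, and likewise for \<open>m\<close>.\<close>
  have pos: "0 < n" "0 < m" if "r < n * s" "c < m * s" for r c
    using that by (auto intro: Nat.gr0I)
  have "has_bochner_integral D
      (\<lambda>x. \<Sum>r<n * s. \<Sum>c<m * s. vec_index u r * (vec_index v c *
        (A x $$ (r mod n, c mod m) * \<Phi> (r div n) x * \<Phi> (c div m) x)))
      (\<Sum>r<n * s. \<Sum>c<m * s. vec_index u r * (vec_index v c * galerkin D \<Phi> n m s A $$ (r, c)))"
    using A pos
    by (intro has_bochner_integral_sum has_bochner_integral_mult_right)
       (auto simp: galerkin_class_def galerkin_index intro!: has_bochner_integral_integrable)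
  moreover have "scalar_prod u (galerkin D \<Phi> n m s A *\<^sub>v v) =
      (\<Sum>r<n * s. \<Sum>c<m * s. vec_index u r * (vec_index v c * galerkin D \<Phi> n m s A $$ (r, c)))"
    using scalar_prod_mult_mat_vec[OF galerkin_carrier u v] by (simp add: ac_simps)
  moreover have "scalar_prod (galerkin_lift \<Phi> n s u x) (A x *\<^sub>v galerkin_lift \<Phi> m s v x) =
      (\<Sum>r<n * s. \<Sum>c<m * s. vec_index u r * (vec_index v c *
        (A x $$ (r mod n, c mod m) * \<Phi> (r div n) x * \<Phi> (c div m) x)))" if "x \<in> space D" for x
    using A that by (intro galerkin_lift_form) (auto simp: galerkin_class_def)
  ultimately show ?thesis
    by (simp cong: has_bochner_integral_cong)
qed

section \<open>Symmetry, skew-symmetry and semi-definiteness of the projection\<close>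

lemma galerkin_transpose_eq:
  assumes A: "A \<in> galerkin_class D \<Phi> n n"
    and eq: "AE x in D. transpose_mat (A x) = a \<cdot>\<^sub>m A x"
  shows "transpose_mat (galerkin D \<Phi> n n s A) = a \<cdot>\<^sub>m galerkin D \<Phi> n n s A"
proof (rule eq_matI)
  fix r c assume "r < dim_row (a \<cdot>\<^sub>m galerkin D \<Phi> n n s A)"
    and "c < dim_col (a \<cdot>\<^sub>m galerkin D \<Phi> n n s A)"
  then have rc: "r < n * s" "c < n * s" by (auto simp: galerkin_def)
  then have rc': "r mod n < n" "c mod n < n" by (auto intro!: mod_less_divisor Nat.gr0I)
  have I: "integrable D (\<lambda>x. A x $$ (k, l) * \<Phi> i x * \<Phi> j x)" if "k < n" "l < n" for k l i j
    using A that by (auto simp: galerkin_class_def)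
  \<comment> \<open>Exchanging \<open>r\<close> and \<open>c\<close> also exchanges the two basis
    factors, whose product is commutative, so only the transposition of \<open>A x\<close> remains.
    The factor \<open>a\<close> covers the symmetric case 1 and the skew-symmetric case -1.\<close>
  have "(LINT x|D. A x $$ (c mod n, r mod n) * \<Phi> (c div n) x * \<Phi> (r div n) x) =
      (LINT x|D. a * (A x $$ (r mod n, c mod n) * \<Phi> (r div n) x * \<Phi> (c div n) x))"
  proof (rule integral_cong_AE)
    show "AE x in D. A x $$ (c mod n, r mod n) * \<Phi> (c div n) x * \<Phi> (r div n) x =
        a * (A x $$ (r mod n, c mod n) * \<Phi> (r div n) x * \<Phi> (c div n) x)"
      using eq AE_space
    proof eventually_elim
      case (elim x)
      then have "A x \<in> carrier_mat n n" using A by (auto simp: galerkin_class_def)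
      then show ?case
        using arg_cong[OF elim(1), of "\<lambda>X. X $$ (r mod n, c mod n)"] rc' by simp
    qed
  qed (use I rc' in auto)
  then show "transpose_mat (galerkin D \<Phi> n n s A) $$ (r, c) = (a \<cdot>\<^sub>m galerkin D \<Phi> n n s A) $$ (r, c)"
    using rc by (simp add: galerkin_index galerkin_carrier[THEN carrier_matD(1)]
        galerkin_carrier[THEN carrier_matD(2)])
qed (simp_all add: galerkin_def)

lemma galerkin_symmetric:
  assumes A: "A \<in> galerkin_class D \<Phi> n n" and "AE x in D. transpose_mat (A x) = A x"
  shows "transpose_mat (galerkin D \<Phi> n n s A) = galerkin D \<Phi> n n s A"
proof -
  have "1 \<cdot>\<^sub>m X = X" for X :: "real mat" by (rule eq_matI) auto
  then show ?thesis
    using galerkin_transpose_eq[OF A, of 1] assms(2) by simp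
qed

lemma galerkin_skew_symmetric:
  assumes A: "A \<in> galerkin_class D \<Phi> n n" and "AE x in D. transpose_mat (A x) = - A x"
  shows "transpose_mat (galerkin D \<Phi> n n s A) = - galerkin D \<Phi> n n s A"
proof -
  have "- X = (- 1 :: real) \<cdot>\<^sub>m X" for X by (rule eq_matI) auto
  then show ?thesis
    using galerkin_transpose_eq[OF A, of "- 1"] assms(2) by simp
qed

lemma has_bochner_integral_nonneg_AE:
  fixes f :: "'a \<Rightarrow> real"
  assumes "has_bochner_integral D f c" and "AE x in D. 0 \<le> f x"
  shows "0 \<le> c"
  using assms integral_nonneg_AE[of f D] by (simp add: has_bochner_integral_iff)

lemma galerkin_psd:
  assumes A: "A \<in> galerkin_class D \<Phi> n n" and psd: "AE x in D. A x \<in> psd_mats n"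
  shows "galerkin D \<Phi> n n s A \<in> psd_mats (n * s)"
proof -
  have "0 \<le> scalar_prod v (galerkin D \<Phi> n n s A *\<^sub>v v)" if "v \<in> carrier_vec (n * s)" for v
    by (rule has_bochner_integral_nonneg_AE[OF galerkin_form[OF A that that]
          eventually_mono[OF psd]]) (simp add: psd_mats_def)
  moreover have "transpose_mat (galerkin D \<Phi> n n s A) = galerkin D \<Phi> n n s A"
    by (rule galerkin_symmetric[OF A eventually_mono[OF psd]]) (simp add: psd_mats_def)
  ultimately show ?thesis by (simp add: psd_mats_def)
qed

text \<open>Projecting the whole block function would give this matrix only up to a permutation of
  indices. The permutation is avoided by lifting \<open>a\<close> and \<open>b\<close> separately
  and adding the forms of \<open>R\<close>, \<open>P\<close> and \<open>S\<close>.\<close>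

lemma galerkin_four_block_psd:
  assumes R: "R \<in> galerkin_class D \<Phi> n n" and P: "P \<in> galerkin_class D \<Phi> n m"
    and S: "S \<in> galerkin_class D \<Phi> m m"
    and psd: "AE x in D. four_block_mat (R x) (P x) (transpose_mat (P x)) (S x) \<in> psd_mats (n + m)"
  shows "four_block_mat (galerkin D \<Phi> n n s R) (galerkin D \<Phi> n m s P)
    (transpose_mat (galerkin D \<Phi> n m s P)) (galerkin D \<Phi> m m s S) \<in> psd_mats (n * s + m * s)"
proof -
  have pt: "AE x in D. transpose_mat (R x) = R x \<and> transpose_mat (S x) = S x \<and>
    (\<forall>a\<in>carrier_vec n. \<forall>b\<in>carrier_vec m. 0 \<le> scalar_prod a (R x *\<^sub>v a) +
      2 * scalar_prod a (P x *\<^sub>v b) + scalar_prod b (S x *\<^sub>v b))"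
    using psd AE_space
  proof eventually_elim
    case (elim x)
    then have "R x \<in> carrier_mat n n" "P x \<in> carrier_mat n m" "S x \<in> carrier_mat m m"
      using R P S by (auto simp: galerkin_class_def)
    with elim show ?case by (simp add: four_block_psd_mats_iff)
  qed
  have "0 \<le> scalar_prod a (galerkin D \<Phi> n n s R *\<^sub>v a) +
      2 * scalar_prod a (galerkin D \<Phi> n m s P *\<^sub>v b) + scalar_prod b (galerkin D \<Phi> m m s S *\<^sub>v b)"
    if a: "a \<in> carrier_vec (n * s)" and b: "b \<in> carrier_vec (m * s)" for a b
    \<comment> \<open>The integrand of the sum is the block form of the parameter matrices at the
      lifts of \<open>a\<close> and \<open>b\<close>, which \<open>pt\<close> makes nonnegative
      almost everywhere.\<close>
    by (rule has_bochner_integral_nonneg_AE[OF has_bochner_integral_add[OF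
          has_bochner_integral_add[OF galerkin_form[OF R a a]
            has_bochner_integral_mult_right[OF galerkin_form[OF P a b]]]
          galerkin_form[OF S b b]] eventually_mono[OF pt]]) simp
  moreover have "transpose_mat (galerkin D \<Phi> n n s R) = galerkin D \<Phi> n n s R"
    "transpose_mat (galerkin D \<Phi> m m s S) = galerkin D \<Phi> m m s S"
    using pt by (auto intro!: galerkin_symmetric[OF R] galerkin_symmetric[OF S])
  ultimately show ?thesis by (simp add: four_block_psd_mats_iff)
qed

section \<open>Orthonormality and non-singularity of the projection\<close>

lemma L2_space_integrable_mult:
  assumes "f \<in> L2_space D" and "g \<in> L2_space D"
  shows "integrable D (\<lambda>x. f x * g x)"
proof (rule Bochner_Integration.integrable_bound)
  show "integrable D (\<lambda>x. (f x)\<^sup>2 + (g x)\<^sup>2)"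
    using assms by (auto simp: L2_space_def)
  have "\<bar>f x * g x\<bar> \<le> (f x)\<^sup>2 + (g x)\<^sup>2" for x
    using sum_squares_bound[of "\<bar>f x\<bar>" "\<bar>g x\<bar>"] abs_ge_zero[of "f x * g x"]
    unfolding abs_mult power2_abs by linarith
  then show "AE x in D. norm (f x * g x) \<le> norm ((f x)\<^sup>2 + (g x)\<^sup>2)"
    by (auto intro: order_trans[OF _ abs_ge_self])
  have [measurable]: "f \<in> borel_measurable D" "g \<in> borel_measurable D"
    using assms by (auto simp: L2_space_def)
  show "(\<lambda>x. f x * g x) \<in> borel_measurable D" by measurable
qed

lemma one_galerkin_class:
  assumes "\<And>i. \<Phi> i \<in> L2_space D"
  shows "(\<lambda>_. 1\<^sub>m n) \<in> galerkin_class D \<Phi> n n"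
  using L2_space_integrable_mult[OF assms assms] by (auto simp: galerkin_class_def mult.assoc)

text \<open>This is orthonormality of the basis in matrix form; it lets \<open>galerkin_form\<close>
  compute norms.\<close>

lemma galerkin_one:
  assumes "\<And>i j. (LINT x|D. \<Phi> i x * \<Phi> j x) = (if i = j then 1 else 0)"
  shows "galerkin D \<Phi> n n s (\<lambda>_. 1\<^sub>m n) = 1\<^sub>m (n * s)"
proof (rule eq_matI)
  fix r c assume "r < dim_row (1\<^sub>m (n * s) :: real mat)" "c < dim_col (1\<^sub>m (n * s) :: real mat)"
  then have rc: "r < n * s" "c < n * s" by auto
  then have "r mod n < n" "c mod n < n" by (auto intro!: mod_less_divisor Nat.gr0I)
  \<comment> \<open>The integral is a product of two Kronecker deltas, one for the position within a
    block and one for the block index.\<close>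
  moreover have "r = c \<longleftrightarrow> r mod n = c mod n \<and> r div n = c div n"
    by (metis div_mult_mod_eq)
  ultimately show "galerkin D \<Phi> n n s (\<lambda>_. 1\<^sub>m n) $$ (r, c) = 1\<^sub>m (n * s) $$ (r, c)"
    using rc by (simp add: galerkin_index assms mult.assoc)
qed (simp_all add: galerkin_def)

text \<open>Parseval's identity for a finite expansion, obtained as \<open>galerkin_form\<close> for
  the constant identity matrix.\<close>

lemma galerkin_lift_norm:
  assumes "orthonormal_basis D \<Phi>" and "v \<in> carrier_vec (n * s)"
  shows "has_bochner_integral D
    (\<lambda>x. scalar_prod (galerkin_lift \<Phi> n s v x) (galerkin_lift \<Phi> n s v x)) (scalar_prod v v)"
proof -
  have \<Phi>: "\<Phi> i \<in> L2_space D" "(LINT x|D. \<Phi> i x * \<Phi> j x) = (if i = j then 1 else 0)" for i j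
    using assms(1) by (auto simp: orthonormal_basis_def)
  have "galerkin D \<Phi> n n s (\<lambda>_. 1\<^sub>m n) *\<^sub>v v = v"
    by (simp add: galerkin_one[OF \<Phi>(2)] assms(2))
  then show ?thesis
    using galerkin_form[OF one_galerkin_class[of \<Phi>, OF \<Phi>(1)] assms(2,2)]
    by (simp add: one_mult_mat_vec[OF galerkin_lift_carrier])
qed

lemma galerkin_invertible:
  assumes \<Phi>: "orthonormal_basis D \<Phi>" and A: "A \<in> galerkin_class D \<Phi> n n"
    and psd: "AE x in D. A x \<in> psd_mats n" and inv: "AE x in D. invertible_mat (A x)"
  shows "invertible_mat (galerkin D \<Phi> n n s A)"
proof (subst invertible_mat_iff_kernel[OF galerkin_carrier], intro ballI impI)
  fix v :: "real vec"
  assume v: "v \<in> carrier_vec (n * s)" and ker: "galerkin D \<Phi> n n s A *\<^sub>v v = 0\<^sub>v (n * s)"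
  let ?w = "galerkin_lift \<Phi> n s v"
  have int: "has_bochner_integral D (\<lambda>x. scalar_prod (?w x) (A x *\<^sub>v ?w x)) 0"
    using galerkin_form[OF A v v] v by (simp add: ker)
  have "AE x in D. 0 \<le> scalar_prod (?w x) (A x *\<^sub>v ?w x)"
    using psd by eventually_elim (simp add: psd_mats_def)
  \<comment> \<open>A nonnegative integrable function with integral 0 vanishes almost
    everywhere.\<close>
  then have "AE x in D. scalar_prod (?w x) (A x *\<^sub>v ?w x) = 0"
    using int integral_nonneg_eq_0_iff_AE[of D "\<lambda>x. scalar_prod (?w x) (A x *\<^sub>v ?w x)"]
    by (simp add: has_bochner_integral_iff)
  with psd inv have "AE x in D. ?w x = 0\<^sub>v n"
    by eventually_elim (auto intro: invertible_psd_mats_definite)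
  then have "AE x in D. scalar_prod (?w x) (?w x) = 0"
    by eventually_elim simp
  then have "scalar_prod v v = 0"
    using galerkin_lift_norm[OF \<Phi> v] integral_eq_zero_AE[of "\<lambda>x. scalar_prod (?w x) (?w x)" D]
    by (simp add: has_bochner_integral_iff)
  then show "v = 0\<^sub>v (n * s)"
    by (rule scalar_prod_real_self_eq_0[OF v])
qed

section \<open>The projected port-Hamiltonian system\<close>

theorem theorem4p3:
  fixes W :: "'w measure" and mu :: "'w \<Rightarrow> real ^ 'q"
    and M :: "(real ^ 'q) set" and \<rho> :: "real ^ 'q \<Rightarrow> real"
    and \<Phi> :: "nat \<Rightarrow> real ^ 'q \<Rightarrow> real"
    and n m s :: nat
    and E J R B P S N :: "real ^ 'q \<Rightarrow> real mat"
  defines "D \<equiv> param_measure M \<rho>"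
  assumes "prob_space W"
    and "M \<in> sets borel"
    and "\<forall>x\<in>M. 0 \<le> \<rho> x"
    and "distributed W (restrict_space lborel M) mu (\<lambda>x. ennreal (\<rho> x))"
    and "prob_space.indep_vars W (\<lambda>_. borel) (\<lambda>k \<omega>. mu \<omega> $ k) UNIV"
    and "\<forall>i. real_polynomial_function (\<Phi> i)"
    and "\<forall>x\<in>M. \<Phi> 0 x = 1"
    and "orthonormal_basis D \<Phi>"
    and "E \<in> galerkin_class D \<Phi> n n" and "J \<in> galerkin_class D \<Phi> n n"
    and "R \<in> galerkin_class D \<Phi> n n"
    and "B \<in> galerkin_class D \<Phi> n m" and "P \<in> galerkin_class D \<Phi> n m"
    and "S \<in> galerkin_class D \<Phi> m m" and "N \<in> galerkin_class D \<Phi> m m"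
    and "AE x in D. invertible_mat (E x) \<and>
           port_hamiltonian n m
             (Descriptor (E x) (J x - R x) (B x - P x) (transpose_mat (B x + P x)) (S x + N x))
             (E x) (J x) (R x) (1\<^sub>m n) (B x) (P x) (S x) (N x)"
    and "1 \<le> s"
  defines "Eh \<equiv> galerkin D \<Phi> n n s E"
    and "Jh \<equiv> galerkin D \<Phi> n n s J"
    and "Rh \<equiv> galerkin D \<Phi> n n s R"
    and "Bh \<equiv> galerkin D \<Phi> n m s B"
    and "Ph \<equiv> galerkin D \<Phi> n m s P"
    and "Sh \<equiv> galerkin D \<Phi> m m s S"
    and "Nh \<equiv> galerkin D \<Phi> m m s N"
  shows "invertible_mat Eh \<and>
         port_hamiltonian (n * s) (m * s)
           (Descriptor Eh (Jh - Rh) (Bh - Ph) (transpose_mat (Bh + Ph)) (Sh + Nh))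
           Eh Jh Rh (1\<^sub>m (n * s)) Bh Ph Sh Nh"
proof -
  note \<Phi> = assms(9) and cls = assms(10-16) and sys = assms(17)
  have pt: "AE x in D. invertible_mat (E x) \<and> transpose_mat (J x) = - J x \<and>
      transpose_mat (N x) = - N x \<and> E x \<in> psd_mats n \<and>
      four_block_mat (R x) (P x) (transpose_mat (P x)) (S x) \<in> psd_mats (n + m)"
    \<comment> \<open>\<open>galerkin_class\<close> fixes matrix dimensions on
      \<open>space D\<close>, so membership of \<open>x\<close> in the space is carried
      along.\<close>
    using sys AE_space
  proof eventually_elim
    case (elim x)
    then have "E x \<in> carrier_mat n n" "J x \<in> carrier_mat n n" "R x \<in> carrier_mat n n"
      "B x \<in> carrier_mat n m" "P x \<in> carrier_mat n m"
      "S x \<in> carrier_mat m m" "N x \<in> carrier_mat m m"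
      using cls by (auto simp: galerkin_class_def)
    with elim(1) show ?case by (simp add: port_hamiltonian_one_iff)
  qed
  have "transpose_mat Jh = - Jh" "transpose_mat Nh = - Nh"
    unfolding Jh_def Nh_def
    using pt by (auto intro!: galerkin_skew_symmetric cls)
  moreover have "Eh \<in> psd_mats (n * s)" "invertible_mat Eh"
    unfolding Eh_def
    using pt by (auto intro!: galerkin_psd galerkin_invertible \<Phi> cls)
  moreover have "four_block_mat Rh Ph (transpose_mat Ph) Sh \<in> psd_mats (n * s + m * s)"
    unfolding Rh_def Ph_def Sh_def
    using pt by (auto intro!: galerkin_four_block_psd cls)
  ultimately show ?thesis
    by (simp add: port_hamiltonian_one_iff Eh_def Jh_def Rh_def Bh_def Ph_def Sh_def Nh_def)
qed

end
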